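(* Let $(q_i^* )_{i\in\mathcal N}$ be an optimal solution of $\min_{q_i\ge0}\sum_{i\in\mathcal N}C_i(q_i)$ s.t. $\sum_{i\in\mathcal N}q_i=d$ in which at least two firms have $q_i^*>0$. If the constant $\phi$ of the efficiency recovery mechanism is set to $$\phi=\frac{\sum_{i\in\mathcal N}\frac{(q_i^* )^2}{d-q_i^*}}{d^2\sum_{i\in\mathcal N}\frac{1}{d-q_i^*}},$$ then the market achieves self-sufficiency at the Nash equilibrium: at a Nash equilibrium $(B,p)$ in the presence of the efficiency recovery mechanism with this $\phi$ and with dispatch $b_ip=q_i^*$ for all $i\in\mathcal N$, one has $$\sum_{i\in\mathcal N}\Delta\pi_i=0.$$
   Context: Market. $\mathcal N=\{1,\dots,|\mathcal N|\}$ is a finite set of firms and $d>0$ is a given inelastic demand. Each firm $i$ has a production cost function $C_i:\mathbb R\to\mathbb R$ that is continuously differentiable, convex and strictly increasing, with $C_i(0)=0$. Each firm $i$ chooses a bid $b_i\ge 0$; at price $p$ it supplies $q_i=b_ip$. Write $B=(b_i)_{i\in\mathcal N}$, $B_{-i}=(b_j)_{j\ne i}$ and $\sum_{-i}b_j=\sum_{j\in\mathcal N\setminus\{i\}}b_j$. Supply matches demand, $\sum_i q_i=d$, through the market clearing price $p(B)=d/\sum_{i}b_i$. If all firms bid $0$, the bids are rejected by the market (the all-zero bid profile is not admissible). Efficiency recovery mechanism with constant $\phi$. Each firm $i$ receives the extra term $$\Delta\pi_i=\frac{q_i^2}{2\sum_{-i}b_j}-\phi\,\frac{d^2}{2\sum_{-i}b_j}\qquad\text{if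 }\sum_{-i}b_j>0,$$ and if $\sum_{-i}b_j=0$, $\Delta\pi_i$ is set to a sufficiently large constant (not depending on $b_i$). Strategic bidding. Given $B_{-i}$, firm $i$ solves $$\max_{b_i\ge 0}\ \pi_i^\dagger(b_i;B_{-i})=p\,q_i-C_i(q_i)+\Delta\pi_i=p^2b_i-C_i(pb_i)+\Delta\pi_i,\qquad p=\frac{d}{\sum_j b_j}$$ (over admissible bids, i.e. with $b_i>0$ when $\sum_{-i}b_j=0$). Nash equilibrium in the presence of the efficiency recovery mechanism: a tuple $(B,p)$ such that (1) for every $i\in\mathcal N$, $b_i$ is optimal for firm $i$'s strategic bidding problem given $B_{-i}$; and (2) supply matches demand, $\sum_i b_ip=d$. *)

theory Defs
  imports "HOL-Analysis.Analysis"
begin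

text \<open>
  Firms are the elements of a finite type \<open>'i\<close>. A bid profile \<open>B\<close> and a dispatch \<open>q\<close> are
  functions from firms to reals, and \<open>C i\<close> is the production cost function of firm \<open>i\<close>.
\<close>

definition feasible_dispatch :: "real \<Rightarrow> ('i::finite \<Rightarrow> real) \<Rightarrow> bool" where
  "feasible_dispatch d q \<longleftrightarrow> (\<forall>i. 0 \<le> q i) \<and> (\<Sum>i\<in>UNIV. q i) = d"

definition optimal_dispatch :: "('i::finite \<Rightarrow> real \<Rightarrow> real) \<Rightarrow> real \<Rightarrow> ('i \<Rightarrow> real) \<Rightarrow> bool" where
  "optimal_dispatch C d q \<longleftrightarrow> is_arg_min (\<lambda>q. \<Sum>i\<in>UNIV. C i (q i)) (feasible_dispatch d) q"

text \<open>The market rejects the all-zero bid profile.\<close>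

definition admissible :: "('i::finite \<Rightarrow> real) \<Rightarrow> bool" where
  "admissible B \<longleftrightarrow> (\<forall>i. 0 \<le> B i) \<and> (\<exists>i. B i \<noteq> 0)"

definition clearing_price :: "real \<Rightarrow> ('i::finite \<Rightarrow> real) \<Rightarrow> real" where
  "clearing_price d B = d / (\<Sum>i\<in>UNIV. B i)"

definition supplied :: "real \<Rightarrow> ('i::finite \<Rightarrow> real) \<Rightarrow> 'i \<Rightarrow> real" where
  "supplied d B i = B i * clearing_price d B"

definition others_bids :: "('i::finite \<Rightarrow> real) \<Rightarrow> 'i \<Rightarrow> real" where
  "others_bids B i = (\<Sum>j\<in>UNIV - {i}. B j)"

text \<open>
  The extra term of firm \<open>i\<close> under the efficiency recovery mechanism with constant \<open>\<phi>\<close>.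
  \<open>K i\<close> is the constant that firm \<open>i\<close> receives when all other firms bid zero; it does not
  depend on the bids and is otherwise left arbitrary (in particular, it may be as large as desired).
\<close>

definition extra_term ::
  "real \<Rightarrow> real \<Rightarrow> ('i::finite \<Rightarrow> real) \<Rightarrow> ('i \<Rightarrow> real) \<Rightarrow> 'i \<Rightarrow> real" where
  "extra_term d \<phi> K B i =
     (if others_bids B i > 0
      then (supplied d B i)\<^sup>2 / (2 * others_bids B i) - \<phi> * (d\<^sup>2 / (2 * others_bids B i))
      else K i)"

definition profit ::
  "('i::finite \<Rightarrow> real \<Rightarrow> real) \<Rightarrow> real \<Rightarrow> real \<Rightarrow> ('i \<Rightarrow> real) \<Rightarrow> ('i \<Rightarrow> real) \<Rightarrow> 'i \<Rightarrow> real" where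
  "profit C d \<phi> K B i =
     clearing_price d B * supplied d B i - C i (supplied d B i) + extra_term d \<phi> K B i"

text \<open>
  In the strategic bidding problem of firm \<open>i\<close>, the decision variable \<open>x\<close> replaces the \<open>i\<close>-th
  bid, so that \<open>B(i := x)\<close> is the profile \<open>(x, B\<^sub>-\<^sub>i)\<close>.
\<close>

definition optimal_bid ::
  "('i::finite \<Rightarrow> real \<Rightarrow> real) \<Rightarrow> real \<Rightarrow> real \<Rightarrow> ('i \<Rightarrow> real) \<Rightarrow> ('i \<Rightarrow> real) \<Rightarrow> 'i \<Rightarrow> bool" where
  "optimal_bid C d \<phi> K B i \<longleftrightarrow>
     is_arg_max (\<lambda>x. profit C d \<phi> K (B(i := x)) i) (\<lambda>x. admissible (B(i := x))) (B i)"

definition nash_equilibrium ::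
  "('i::finite \<Rightarrow> real \<Rightarrow> real) \<Rightarrow> real \<Rightarrow> real \<Rightarrow> ('i \<Rightarrow> real) \<Rightarrow> ('i \<Rightarrow> real) \<Rightarrow> real \<Rightarrow> bool" where
  "nash_equilibrium C d \<phi> K B p \<longleftrightarrow>
     (\<forall>i. optimal_bid C d \<phi> K B i) \<and> (\<Sum>i\<in>UNIV. B i * p) = d"

end

theory Submission
  imports Defs
begin

text \<open>
  The idea is that \<open>\<phi> d\<^sup>2\<close> is a weighted mean. If the equilibrium clears the market at price \<open>p\<close>
  with dispatch \<open>q\<close>, then the other firms supply \<open>p \<Sum>\<^sub>-\<^sub>i b\<^sub>j = d - q\<^sub>i\<close>, so the extra term of firm
  \<open>i\<close> is \<open>p/2\<close> times \<open>(q\<^sub>i\<^sup>2 - \<phi> d\<^sup>2) / (d - q\<^sub>i)\<close> (lemma \<open>extra_term_eq_weighted_deviation\<close>).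
  The prescribed \<open>\<phi>\<close> makes \<open>\<phi> d\<^sup>2\<close> the mean of the \<open>q\<^sub>i\<^sup>2\<close> with weights \<open>1 / (d - q\<^sub>i)\<close>, and the
  weighted deviations from a weighted mean cancel (lemma \<open>sum_weighted_deviation_from_mean\<close>).

  Two active firms are what makes all weights positive: no firm then covers the whole demand
  (lemma \<open>dispatch_less_demand\<close>). This also puts every firm in the branch of the
  mechanism in which the other firms' total bid is positive.
\<close>

lemma sum_weighted_deviation_from_mean:
  fixes w x :: "'a \<Rightarrow> 'b::field"
  assumes "sum w A \<noteq> 0" and "m = (\<Sum>i\<in>A. x i * w i) / sum w A"
  shows "(\<Sum>i\<in>A. (x i - m) * w i) = 0"
proof -
  have "(\<Sum>i\<in>A. (x i - m) * w i) = (\<Sum>i\<in>A. x i * w i) - m * sum w A"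
    by (simp add: left_diff_distrib sum_subtractf sum_distrib_left)
  then show ?thesis
    using assms by simp
qed

lemma dispatch_less_demand:
  assumes "feasible_dispatch d q" and "card {i. q i > 0} \<ge> 2"
  shows "q i < d"
proof -
  have "\<not> {i. q i > 0} \<subseteq> {i}"
    using assms(2) card_mono[of "{i}" "{i. q i > 0}"] by auto
  then obtain j where j: "j \<noteq> i" "q j > 0"
    by auto
  then have "q i < sum q {i, j}"
    by simp
  also have "\<dots> \<le> sum q UNIV"
    using assms(1) by (intro sum_mono2) (auto simp: feasible_dispatch_def)
  finally show ?thesis
    using assms(1) by (simp add: feasible_dispatch_def)
qed

lemma nash_equilibrium_imp_admissible:
  assumes "nash_equilibrium C d \<phi> K B p"
  shows "admissible B"
  using assms by (auto simp: nash_equilibrium_def optimal_bid_def is_arg_max_def)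

lemma sum_bids_pos:
  assumes "admissible B"
  shows "(\<Sum>i\<in>UNIV. B i) > 0"
proof -
  obtain i where "B i > 0"
    using assms by (auto simp: admissible_def less_le)
  then show ?thesis
    using assms by (intro sum_pos2[of UNIV i]) (auto simp: admissible_def)
qed

text \<open>
  Multiplying the bids by the price turns the denominator \<open>\<Sum>\<^sub>-\<^sub>i b\<^sub>j\<close> of the mechanism into
  the residual demand left by firm \<open>i\<close>; the price survives only as a factor common to all firms.
\<close>

lemma extra_term_eq_weighted_deviation:
  assumes "d > 0" and "admissible B"
    and market_clears: "(\<Sum>i\<in>UNIV. B i * p) = d"
    and "B i * p < d"
  shows "extra_term d \<phi> K B i
       = p / 2 * (((B i * p)\<^sup>2 - \<phi> * d\<^sup>2) * (1 / (d - B i * p)))"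
proof -
  have S: "(\<Sum>i\<in>UNIV. B i) > 0"
    by (rule sum_bids_pos) fact
  have price: "(\<Sum>i\<in>UNIV. B i) * p = d"
    using market_clears by (simp add: sum_distrib_right)
  then have p: "p > 0"
    using S \<open>d > 0\<close> by (metis zero_less_mult_pos)
  have "clearing_price d B = p"
    using price S by (auto simp: clearing_price_def field_simps)
  then have supplied: "supplied d B i = B i * p"
    by (simp add: supplied_def)
  have "(\<Sum>j\<in>UNIV. B j) = B i + others_bids B i"
    unfolding others_bids_def by (rule sum.remove) auto
  then have residual: "d - B i * p = others_bids B i * p"
    using price by (simp add: algebra_simps)
  then have others: "others_bids B i > 0"
    using \<open>B i * p < d\<close> p by (metis diff_gt_0_iff_gt zero_less_mult_pos2)
  show ?thesis
    unfolding extra_term_def residual supplied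
    using others p by (simp add: field_simps)
qed

theorem corollary3p4:
  fixes C :: "'i::finite \<Rightarrow> real \<Rightarrow> real"
    and d \<phi> p :: real
    and K qs B :: "'i \<Rightarrow> real"
  assumes "d > 0"
    and "\<And>i. C i C1_differentiable_on UNIV"
    and "\<And>i. convex_on UNIV (C i)"
    and "\<And>i. strict_mono (C i)"
    and "\<And>i. C i 0 = 0"
    and "optimal_dispatch C d qs"
    and "card {i. qs i > 0} \<ge> 2"
    and "\<phi> = (\<Sum>i\<in>UNIV. (qs i)\<^sup>2 / (d - qs i)) / (d\<^sup>2 * (\<Sum>i\<in>UNIV. 1 / (d - qs i)))"
    and "nash_equilibrium C d \<phi> K B p"
    and "\<And>i. B i * p = qs i"
  shows "(\<Sum>i\<in>UNIV. extra_term d \<phi> K B i) = 0"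
proof -
  let ?w = "\<lambda>i. 1 / (d - qs i)"
  have "feasible_dispatch d qs"
    using assms(6) by (simp add: optimal_dispatch_def is_arg_min_def)
  then have less: "qs i < d" for i
    using assms(7) by (rule dispatch_less_demand)
  have weights: "sum ?w UNIV > 0"
    using less by (intro sum_pos) auto
  have mean: "\<phi> * d\<^sup>2 = (\<Sum>i\<in>UNIV. (qs i)\<^sup>2 * ?w i) / sum ?w UNIV"
    using assms(8) \<open>d > 0\<close> by simp
  have "admissible B"
    using assms(9) by (rule nash_equilibrium_imp_admissible)
  moreover have "(\<Sum>i\<in>UNIV. B i * p) = d"
    using assms(9) by (simp add: nash_equilibrium_def)
  ultimately have "extra_term d \<phi> K B i = p / 2 * (((qs i)\<^sup>2 - \<phi> * d\<^sup>2) * ?w i)" for i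
    using extra_term_eq_weighted_deviation[of d B p i \<phi> K] assms(1,10) less by simp
  then have "(\<Sum>i\<in>UNIV. extra_term d \<phi> K B i)
      = p / 2 * (\<Sum>i\<in>UNIV. ((qs i)\<^sup>2 - \<phi> * d\<^sup>2) * ?w i)"
    by (simp only: sum_distrib_left)
  also have "(\<Sum>i\<in>UNIV. ((qs i)\<^sup>2 - \<phi> * d\<^sup>2) * ?w i) = 0"
    using weights mean by (intro sum_weighted_deviation_from_mean) auto
  finally show ?thesis
    by simp
qed

end
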